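(* Let $F$ be the cdf of the finite mixed skew-$t$ distribution with parameters $0<v_1<\dots<v_r$, $\beta_i\in\mathbb{R}$, $p_i>0$, $\sum_{i=1}^rp_i=1$. With $\alpha_n=a_n$ and $\beta_n=1/v_1$, where $$a_n=\big(2p_1C_{v_1}T_{v_1+1}(\beta_1\sqrt{v_1+1})\big)^{\frac1{v_1}}v_1^{\frac{v_1-1}{2v_1}}n^{\frac1{v_1}}$$ (in this formula $\beta_1$ denotes the skewness parameter of the first mixture component), we have, for every $x\in\mathbb{R}$, $$\lim_{n\to\infty}F^n\big(\alpha_n|x|^{\beta_n}\operatorname{sign}(x)\big)=\Phi_1(x).$$
   Context: Student $t$: for $v>0$, $t_v(x)=C_v(1+x^2/v)^{-(v+1)/2}$ with $C_v=\frac{\Gamma((v+1)/2)}{\Gamma(v/2)\sqrt{v\pi}}$ is the pdf, and $T_v$ is the cdf, of the standard Student $t$ distribution with $v$ degrees of freedom. Skew-$t$: $\mathrm{ST}_v(\beta)$ ($v>0$, $\beta\in\mathbb{R}$) is the distribution on $\mathbb{R}$ with pdf $2t_v(x)T_{v+1}\big(\beta x\sqrt{\tfrac{v+1}{x^2+v}}\big)$; its cdf is denoted $F_{v,\beta}$. Mixed skew-$t$ distribution with $r$ components: given $0<v_1<v_2<\dots<v_r$, $\beta_i\in\mathbb{R}$, $p_i>0$ with $\sum_{i=1}^rp_i=1$, it is the distribution with cdf $F(x)=\sum_{i=1}^rp_iF_{v_i,\beta_i}(x)$. $\Phi_1$ is the distribution function $\Phi_1(x)=\exp(-x^{-1})$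 for $x>0$ and $\Phi_1(x)=0$ for $x\le0$; $\operatorname{sign}(0)=0$. *)

theory Defs
  imports "HOL-Probability.Probability"
begin

definition student_t_const :: "real \<Rightarrow> real" where
  "student_t_const v = Gamma ((v + 1) / 2) / (Gamma (v / 2) * sqrt (v * pi))"

definition student_t_pdf :: "real \<Rightarrow> real \<Rightarrow> real" where
  "student_t_pdf v x = student_t_const v * (1 + x\<^sup>2 / v) powr (- (v + 1) / 2)"

definition student_t :: "real \<Rightarrow> real measure" where
  "student_t v = density lborel (\<lambda>x. ennreal (student_t_pdf v x))"

definition student_t_cdf :: "real \<Rightarrow> real \<Rightarrow> real" where
  "student_t_cdf v = cdf (student_t v)"

definition skew_t_pdf :: "real \<Rightarrow> real \<Rightarrow> real \<Rightarrow> real" where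
  "skew_t_pdf v \<beta> x =
     2 * student_t_pdf v x * student_t_cdf (v + 1) (\<beta> * x * sqrt ((v + 1) / (x\<^sup>2 + v)))"

definition skew_t :: "real \<Rightarrow> real \<Rightarrow> real measure" where
  "skew_t v \<beta> = density lborel (\<lambda>x. ennreal (skew_t_pdf v \<beta> x))"

definition skew_t_cdf :: "real \<Rightarrow> real \<Rightarrow> real \<Rightarrow> real" where
  "skew_t_cdf v \<beta> = cdf (skew_t v \<beta>)"

text \<open>Components are indexed by \<open>1, \<dots>, r\<close>; values of \<open>p\<close>, \<open>v\<close> and \<open>\<beta>\<close> at other indices
  are irrelevant.\<close>

definition mixed_skew_t_cdf ::
    "nat \<Rightarrow> (nat \<Rightarrow> real) \<Rightarrow> (nat \<Rightarrow> real) \<Rightarrow> (nat \<Rightarrow> real) \<Rightarrow> real \<Rightarrow> real" where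
  "mixed_skew_t_cdf r p v \<beta> x = (\<Sum>i = 1..r. p i * skew_t_cdf (v i) (\<beta> i) x)"

definition Phi_1 :: "real \<Rightarrow> real" where
  "Phi_1 x = (if x > 0 then exp (- inverse x) else 0)"

end

theory Submission
  imports Defs "HOL-Real_Asymp.Real_Asymp"
begin

text \<open>
  The upper tail of a mixed skew-\<open>t\<close> distribution is asymptotically a pure power, and the heaviest
  component, the one with the fewest degrees of freedom \<open>v 1\<close>, decides it:
  \<open>y powr v 1 * (1 - F y)\<close> tends to a constant \<open>K > 0\<close> as \<open>y\<close> tends to infinity. The sequence \<open>a\<close>
  is chosen so that \<open>a n powr v 1 = K * n\<close>. For \<open>x > 0\<close> the point
  \<open>y n = a n * x powr (1 / v 1)\<close> then satisfies \<open>y n powr v 1 = K * n * x\<close>, so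
  \<open>n * (1 - F (y n))\<close> tends to \<open>1 / x\<close>, and the Poisson-type limit \<open>power_tendsto_exp_of_mean\<close>
  turns this into \<open>F (y n) ^ n \<longlonglongrightarrow> exp (- 1 / x)\<close>. For \<open>x \<le> 0\<close> the argument is at most \<open>0\<close>, and
  \<open>F 0 < 1\<close> forces the powers to \<open>0\<close>; this inequality also follows from the tail limit, since a
  distribution function that reaches \<open>1\<close> has no tail left.

  The tail constant comes from \<open>tail_density_regular_variation\<close>: a probability density \<open>f\<close> with
  \<open>f y * y powr (v + 1)\<close> tending to \<open>c\<close> may be integrated to give the tail constant \<open>c / v\<close>. For
  the skew-\<open>t\<close> density the Student factor supplies the power, and the skewing factor tends to
  \<open>student_t_cdf (v + 1) (\<beta> * sqrt (v + 1))\<close>, because its argument tends to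
  \<open>\<beta> * sqrt (v + 1)\<close>; this number is positive, so the constant does not degenerate.

  Passing from densities to \<open>1 - F\<close> needs total mass one. For the Student density it comes from
  writing it as a Gamma mixture of Gaussians (\<open>prob_space_student_t\<close>), and for the skew-\<open>t\<close> density
  from a symmetry argument (\<open>prob_space_skew_symmetric\<close>).
\<close>

section \<open>Normalisation of the Student density\<close>

text \<open>This is the total mass of the normal density whose variance is \<open>1 / (2 * K)\<close>.\<close>

lemma nn_integral_gaussian:
  fixes K :: real
  assumes K: "K > 0"
  shows "(\<integral>\<^sup>+x. ennreal (exp (- K * x\<^sup>2)) \<partial>lborel) = ennreal (sqrt (pi / K))"
proof -
  define \<sigma> where "\<sigma> = 1 / sqrt (2 * K)"
  have \<sigma>: "\<sigma> > 0" "2 * \<sigma>\<^sup>2 = 1 / K"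
    using K by (auto simp: \<sigma>_def power_divide)
  have dens: "exp (- K * x\<^sup>2) = sqrt (pi / K) * normal_density 0 \<sigma> x" for x
  proof -
    have "2 * pi * \<sigma>\<^sup>2 = pi / K" "x\<^sup>2 / (2 * \<sigma>\<^sup>2) = K * x\<^sup>2"
      using \<sigma> K by (simp_all add: field_simps)
    then show ?thesis using K by (simp add: normal_density_def)
  qed
  interpret prob_space "density lborel (normal_density 0 \<sigma>)"
    by (rule prob_space_normal_density) (rule \<sigma>)
  have "(\<integral>\<^sup>+x. ennreal (normal_density 0 \<sigma> x) \<partial>lborel) = 1"
    using emeasure_space_1 by (simp add: emeasure_density)
  then show ?thesis
    using K by (simp only: dens) (simp add: ennreal_mult' nn_integral_cmult)
qed

lemma nn_integral_Gamma_scaled: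
  fixes s b :: real
  assumes s: "s > 0" and b: "b > 0"
  shows "(\<integral>\<^sup>+t. ennreal (indicator {0..} t * t powr (s - 1) * exp (- b * t)) \<partial>lborel)
           = ennreal (Gamma s * b powr (- s))"
proof -
  let ?I = "\<integral>\<^sup>+t. ennreal (indicator {0..} t * t powr (s - 1) * exp (- b * t)) \<partial>lborel"
  have "ennreal (Gamma s)
      = ennreal b * (\<integral>\<^sup>+t. ennreal (indicator {0..} (b * t) * (b * t) powr (s - 1) / exp (b * t)) \<partial>lborel)"
    using b by (subst Gamma_conv_nn_integral_real[OF s], subst nn_integral_real_affine[where c = b and t = 0]) auto
  also have "(\<integral>\<^sup>+t. ennreal (indicator {0..} (b * t) * (b * t) powr (s - 1) / exp (b * t)) \<partial>lborel)
      = (\<integral>\<^sup>+t. ennreal (b powr (s - 1)) * ennreal (indicator {0..} t * t powr (s - 1) * exp (- b * t)) \<partial>lborel)"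
    using b by (intro nn_integral_cong)
      (auto simp: indicator_def zero_le_mult_iff powr_mult exp_minus field_simps simp flip: ennreal_mult')
  also have "\<dots> = ennreal (b powr (s - 1)) * ?I"
    by (rule nn_integral_cmult) measurable
  also have "ennreal b * (ennreal (b powr (s - 1)) * ?I) = ennreal (b powr s) * ?I"
    using b by (simp add: mult.assoc[symmetric] powr_diff flip: ennreal_mult')
  finally have eq: "ennreal (Gamma s) = ennreal (b powr s) * ?I" .
  have "ennreal (Gamma s * b powr (- s)) = ennreal (b powr (- s)) * (ennreal (b powr s) * ?I)"
    unfolding eq[symmetric] using s by (simp add: Gamma_real_pos less_imp_le mult.commute flip: ennreal_mult')
  also have "\<dots> = ?I"
    using b by (simp add: mult.assoc[symmetric] powr_minus flip: ennreal_mult')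
  finally show ?thesis by simp
qed

lemma student_t_const_pos: "v > 0 \<Longrightarrow> student_t_const v > 0"
  by (simp add: student_t_const_def Gamma_real_pos)

lemma student_t_pdf_nonneg: "v > 0 \<Longrightarrow> student_t_pdf v x \<ge> 0"
  using student_t_const_pos[of v] by (simp add: student_t_pdf_def)

lemma student_t_pdf_even: "student_t_pdf v (- x) = student_t_pdf v x"
  by (simp add: student_t_pdf_def)

lemma student_t_pdf_measurable[measurable]: "student_t_pdf v \<in> borel_measurable borel"
  unfolding student_t_pdf_def by measurable

text \<open>
  With \<open>s = (v + 1) / 2\<close>, the scaled Gamma integral gives
  \<open>Gamma s * (1 + x\<^sup>2 / v) powr (- s) = \<integral> t powr (s - 1) * exp (- (1 + x\<^sup>2 / v) * t) dt\<close>.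
  Integrating in \<open>x\<close> first leaves a Gaussian integral with value \<open>sqrt (v * pi / t)\<close>, which lowers
  the exponent of \<open>t\<close> by one half; the remaining integral is \<open>Gamma (v / 2)\<close>.
\<close>

lemma prob_space_student_t:
  assumes v: "v > 0"
  shows "prob_space (student_t v)"
proof
  define s where "s = (v + 1) / 2"
  have s: "s > 0" and vs: "v / 2 = s - 1 / 2" using v by (auto simp: s_def field_simps)
  let ?g = "\<lambda>x t. ennreal (indicator {0..} t * t powr (s - 1) * exp (- (1 + x\<^sup>2 / v) * t))"
  have "(\<integral>\<^sup>+x. ennreal (Gamma s * (1 + x\<^sup>2 / v) powr (- s)) \<partial>lborel)
      = (\<integral>\<^sup>+x. (\<integral>\<^sup>+t. ?g x t \<partial>lborel) \<partial>lborel)"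
    using v s by (intro nn_integral_cong nn_integral_Gamma_scaled[symmetric]) (auto intro: add_pos_nonneg)
  also have "\<dots> = (\<integral>\<^sup>+t. (\<integral>\<^sup>+x. ?g x t \<partial>lborel) \<partial>lborel)"
    by (rule lborel_pair.Fubini') measurable
  also have "\<dots> = (\<integral>\<^sup>+t. ennreal (sqrt (v * pi)) *
        ennreal (indicator {0..} t * t powr (v / 2 - 1) * exp (- 1 * t)) \<partial>lborel)"
  proof (intro nn_integral_cong)
    fix t :: real
    show "(\<integral>\<^sup>+x. ?g x t \<partial>lborel)
        = ennreal (sqrt (v * pi)) * ennreal (indicator {0..} t * t powr (v / 2 - 1) * exp (- 1 * t))"
    proof (cases "t > 0")
      case True
      have "(\<integral>\<^sup>+x. ?g x t \<partial>lborel)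
          = (\<integral>\<^sup>+x. ennreal (t powr (s - 1) * exp (- t)) * ennreal (exp (- (t / v) * x\<^sup>2)) \<partial>lborel)"
        using True by (intro nn_integral_cong)
          (simp add: algebra_simps mult_exp_exp flip: ennreal_mult')
      also have "\<dots> = ennreal (t powr (s - 1) * exp (- t)) * ennreal (sqrt (pi / (t / v)))"
        using True v by (subst nn_integral_cmult) (simp_all only: nn_integral_gaussian divide_pos_pos, measurable)
      also have "\<dots> = ennreal (sqrt (v * pi) * (t powr (s - 1) / sqrt t) * exp (- t))"
        using True v by (simp add: real_sqrt_divide real_sqrt_mult mult_ac flip: ennreal_mult')
      also have "t powr (s - 1) / sqrt t = t powr (v / 2 - 1)"
        using True unfolding vs by (simp add: powr_half_sqrt[symmetric] powr_diff[symmetric])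
      finally show ?thesis using True v by (simp add: mult.assoc ennreal_mult')
    next
      case False
      then have "t < 0 \<or> t = 0" by auto
      then show ?thesis by auto
    qed
  qed
  also have "\<dots> = ennreal (sqrt (v * pi) * Gamma (v / 2))"
    using v by (subst nn_integral_cmult) (simp_all only: nn_integral_Gamma_scaled half_gt_zero_iff, auto simp: ennreal_mult')
  finally have main: "(\<integral>\<^sup>+x. ennreal (Gamma s * (1 + x\<^sup>2 / v) powr (- s)) \<partial>lborel)
      = ennreal (sqrt (v * pi) * Gamma (v / 2))" .
  define k where "k = Gamma (v / 2) * sqrt (v * pi)"
  have k: "k > 0" using v by (simp add: k_def Gamma_real_pos)
  have "emeasure (student_t v) (space (student_t v)) = (\<integral>\<^sup>+x. ennreal (student_t_pdf v x) \<partial>lborel)"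
    by (simp add: student_t_def emeasure_density)
  also have "\<dots> = (\<integral>\<^sup>+x. ennreal (1 / k) * ennreal (Gamma s * (1 + x\<^sup>2 / v) powr (- s)) \<partial>lborel)"
  proof (intro nn_integral_cong)
    fix x :: real
    have "- (v + 1) / 2 = - s" by (simp only: s_def minus_divide_left)
    then show "ennreal (student_t_pdf v x)
        = ennreal (1 / k) * ennreal (Gamma s * (1 + x\<^sup>2 / v) powr (- s))"
      using k unfolding student_t_pdf_def student_t_const_def k_def s_def[symmetric]
      by (simp flip: ennreal_mult')
  qed
  also have "\<dots> = ennreal (1 / k) * ennreal k"
    by (subst nn_integral_cmult) (simp_all add: main k_def mult.commute)
  also have "\<dots> = 1" using k by (simp flip: ennreal_mult')
  finally show "emeasure (student_t v) (space (student_t v)) = 1" .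
qed

section \<open>Distributions on the line with a density\<close>

lemma real_distribution_density:
  assumes "prob_space (density lborel f)"
  shows "real_distribution (density lborel f)"
  using assms by (simp add: real_distribution_def real_distribution_axioms_def)

lemma measure_density_singleton:
  fixes x :: real
  assumes [measurable]: "f \<in> borel_measurable borel"
  shows "measure (density lborel f) {x} = 0"
proof -
  have "AE y in lborel. y \<in> {x} \<longrightarrow> f y = 0"
    by (rule eventually_mono[OF AE_lborel_singleton[of x]]) auto
  then have "{x} \<in> null_sets (density lborel f)"
    by (subst null_sets_density_iff) auto
  then show ?thesis by (simp add: measure_def null_setsD1)
qed

lemma isCont_cdf_density:
  fixes x :: real
  assumes "prob_space (density lborel f)" and "f \<in> borel_measurable borel"
  shows "isCont (cdf (density lborel f)) x"
proof -
  interpret real_distribution "density lborel f"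
    by (rule real_distribution_density) fact
  show ?thesis using assms by (simp add: isCont_cdf measure_density_singleton)
qed

text \<open>
  Reflection maps the lower tail at \<open>- x\<close> to the closed upper tail at \<open>x\<close>, which differs from the
  complement of \<open>{..x}\<close> only by the null set \<open>{x}\<close>.
\<close>

lemma cdf_density_uminus:
  fixes x :: real
  assumes prob: "prob_space (density lborel f)"
    and [measurable]: "f \<in> borel_measurable borel"
    and even: "\<And>x. f (- x) = f x"
  shows "cdf (density lborel f) (- x) = 1 - cdf (density lborel f) x"
proof -
  let ?M = "density lborel f"
  interpret real_distribution ?M
    by (rule real_distribution_density) fact
  have "emeasure ?M {..- x} = (\<integral>\<^sup>+y. f y * indicator {..- x} y \<partial>lborel)"
    by (simp add: emeasure_density)
  also have "\<dots> = (\<integral>\<^sup>+y. f (- y) * indicator {..- x} (- y) \<partial>lborel)"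
    by (subst nn_integral_real_affine[where c = "-1" and t = 0]) auto
  also have "\<dots> = (\<integral>\<^sup>+y. f y * indicator {x..} y \<partial>lborel)"
    by (intro nn_integral_cong) (auto simp: even indicator_def)
  also have "\<dots> = emeasure ?M {x..}"
    by (simp add: emeasure_density)
  finally have "prob {..- x} = prob {x..}" by (simp add: measure_def)
  also have "\<dots> = prob {x} + prob {x<..}"
    by (subst finite_measure_Union[symmetric]) (auto intro!: arg_cong[where f = prob])
  also have "prob {x<..} = 1 - prob {..x}"
    using prob_compl[of "{..x}"] by (simp add: Compl_eq_Diff_UNIV[symmetric])
  finally show ?thesis by (simp add: cdf_def2 measure_density_singleton)
qed

text \<open>
  The case of Karamata's theorem in which the slowly varying factor has a limit. Beyond some \<open>N\<close> the
  density differs from \<open>c * y powr (- v - 1)\<close> by at most \<open>\<epsilon> * y powr (- v - 1)\<close>, and the integral of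
  \<open>y powr (- v - 1)\<close> over \<open>{x..}\<close> is \<open>x powr (- v) / v\<close>, so integrating the bound controls the tail
  relative to \<open>x powr (- v)\<close>.
\<close>

lemma tail_density_regular_variation:
  fixes f :: "real \<Rightarrow> real" and v c :: real
  assumes prob: "prob_space (density lborel (\<lambda>x. ennreal (f x)))"
    and [measurable]: "f \<in> borel_measurable borel" and nonneg: "\<And>x. f x \<ge> 0"
    and v: "v > 0"
    and lim: "((\<lambda>x. f x * x powr (v + 1)) \<longlongrightarrow> c) at_top"
  shows "((\<lambda>x. x powr v * (1 - cdf (density lborel (\<lambda>x. ennreal (f x))) x)) \<longlongrightarrow> c / v) at_top"
proof (rule tendstoI)
  let ?M = "density lborel (\<lambda>x. ennreal (f x))"
  interpret real_distribution ?M
    by (rule real_distribution_density) fact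
  fix e :: real assume e: "e > 0"
  have "(\<integral>\<^sup>+x. ennreal (f x) \<partial>lborel) = 1"
    using emeasure_space_1 by (simp add: emeasure_density)
  then have int: "integrable lborel f"
    by (intro integrableI_nonneg) (auto simp: nonneg)
  have e': "e * v / 2 > 0" using e v by simp
  \<comment> \<open>The factor \<open>v\<close> cancels against the integral of the power, and the half makes the
    final bound strict.\<close>
  from lim have "eventually (\<lambda>x. dist (f x * x powr (v + 1)) c < e * v / 2) at_top"
    by (rule tendstoD) fact
  then obtain N where N: "\<And>y. y \<ge> N \<Longrightarrow> dist (f y * y powr (v + 1)) c < e * v / 2"
    by (auto simp: eventually_at_top_linorder)
  have "dist (x powr v * (1 - cdf ?M x)) (c / v) < e" if x: "x \<ge> N" "x > 0" for x
  proof -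
    let ?p = "\<lambda>y. y powr (- v - 1)"
    have hi: "(?p has_integral x powr (- v) / v) {x..}"
      using has_integral_powr_to_inf[of "- v - 1" x] x v by (simp add: field_simps)
    then have "(?p absolutely_integrable_on {x..})"
      by (intro nonnegative_absolutely_integrable_1) (auto simp: has_integral_iff)
    then have si: "set_integrable lborel {x..} ?p"
      by (simp add: absolutely_integrable_on_def set_integrable_def integrable_completion)
    then have sp: "(LINT y:{x..}|lborel. ?p y) = x powr (- v) / v"
      using set_borel_integral_eq_integral(2)[OF si] hi by (simp add: has_integral_iff)
    have sf: "set_integrable lborel {x..} f"
      unfolding set_integrable_def using int by (intro integrable_mult_indicator) auto
    have "1 - cdf ?M x = prob {x<..}"
      using prob_compl[of "{..x}"] by (simp add: cdf_def2 Compl_eq_Diff_UNIV[symmetric])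
    also have "\<dots> = prob {x} + prob {x<..}"
      by (simp add: measure_density_singleton)
    also have "\<dots> = prob {x..}"
      by (subst finite_measure_Union[symmetric]) (auto intro!: arg_cong[where f = prob])
    also have "\<dots> = (LINT y:{x..}|lborel. f y)"
    proof -
      have "emeasure ?M {x..} = (\<integral>\<^sup>+y. ennreal (indicator {x..} y * f y) \<partial>lborel)"
        by (subst emeasure_density) (auto intro!: nn_integral_cong simp: indicator_def)
      also have "\<dots> = ennreal (LINT y:{x..}|lborel. f y)"
        using sf unfolding set_integrable_def set_lebesgue_integral_def
        by (subst nn_integral_eq_integral) (auto simp: nonneg)
      finally show ?thesis
        by (simp add: measure_def set_lebesgue_integral_def nonneg integral_nonneg_AE)
    qed
    finally have tail: "1 - cdf ?M x = (LINT y:{x..}|lborel. f y)" .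
    have sc: "set_integrable lborel {x..} (\<lambda>y. c * ?p y)" "set_integrable lborel {x..} (\<lambda>y. e * v / 2 * ?p y)"
      using si by (auto simp del: mult_minus_left)
    have "\<bar>(LINT y:{x..}|lborel. f y) - c * (x powr (- v) / v)\<bar>
        = \<bar>LINT y:{x..}|lborel. f y - c * ?p y\<bar>"
      using sf sc by (simp add: set_integral_diff sp[symmetric])
    also have "\<dots> \<le> (LINT y:{x..}|lborel. \<bar>f y - c * ?p y\<bar>)"
      using set_integral_norm_bound[OF set_integral_diff(1)[OF sf sc(1)]] by simp
    also have "\<dots> \<le> (LINT y:{x..}|lborel. e * v / 2 * ?p y)"
    proof (intro set_integral_mono)
      show "set_integrable lborel {x..} (\<lambda>y. \<bar>f y - c * ?p y\<bar>)"
        using set_integrable_norm[OF set_integral_diff(1)[OF sf sc(1)]] by simp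
      fix y assume "y \<in> {x..}"
      then have y: "y \<ge> N" "y > 0" using x by auto
      have "\<bar>f y - c * ?p y\<bar> = \<bar>(f y * y powr (v + 1) - c) * ?p y\<bar>"
        using y by (simp add: algebra_simps flip: powr_add)
      also have "\<dots> \<le> e * v / 2 * ?p y"
        unfolding abs_mult using N[OF y(1)] by (intro mult_mono) (use e v in \<open>auto simp: dist_real_def\<close>)
      finally show "\<bar>f y - c * ?p y\<bar> \<le> e * v / 2 * ?p y" .
    qed (use sc in auto)
    also have "\<dots> = e / 2 * x powr (- v)"
      using sp v by simp
    finally have b: "\<bar>(1 - cdf ?M x) - c * (x powr (- v) / v)\<bar> \<le> e / 2 * x powr (- v)"
      by (simp only: tail)
    have "\<bar>x powr v * (1 - cdf ?M x) - c / v\<bar> = x powr v * \<bar>(1 - cdf ?M x) - c * (x powr (- v) / v)\<bar>"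
    proof -
      have "x powr v * (1 - cdf ?M x) - c / v = x powr v * ((1 - cdf ?M x) - c * (x powr (- v) / v))"
        using x by (simp add: right_diff_distrib powr_minus)
      then show ?thesis by (simp add: abs_mult)
    qed
    also have "\<dots> \<le> x powr v * (e / 2 * x powr (- v))"
      by (intro mult_left_mono b) auto
    also have "\<dots> = e / 2" using x by (simp add: powr_minus)
    finally show ?thesis using e by (simp add: dist_real_def)
  qed
  then show "eventually (\<lambda>x. dist (x powr v * (1 - cdf ?M x)) (c / v) < e) at_top"
    using eventually_conj[OF eventually_ge_at_top[of N] eventually_gt_at_top[of 0]]
    by (auto elim: eventually_mono)
qed

text \<open>
  A positive limit makes the tail positive at arbitrarily large points, and by monotonicity
  everywhere to their left.
\<close>

lemma less_1_of_tail_limit: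
  fixes F :: "real \<Rightarrow> real"
  assumes mono: "mono F"
    and lim: "((\<lambda>x. x powr v * (1 - F x)) \<longlongrightarrow> d) at_top" and d: "d > 0"
  shows "F x < 1"
proof -
  have "eventually (\<lambda>y. y powr v * (1 - F y) > 0) at_top"
    using lim d by (rule order_tendstoD)
  then have "eventually (\<lambda>y. y \<ge> x \<and> y powr v * (1 - F y) > 0) at_top"
    using eventually_ge_at_top[of x] by eventually_elim auto
  then obtain y where "y \<ge> x" "y powr v * (1 - F y) > 0"
    using eventually_happens trivial_limit_at_top_linorder by blast
  then show ?thesis
    using monoD[OF mono, of x y] by (auto simp: zero_less_mult_iff)
qed

section \<open>The Student distribution function\<close>

lemma real_distribution_student_t: "v > 0 \<Longrightarrow> real_distribution (student_t v)"
  using prob_space_student_t[of v] by (simp add: student_t_def real_distribution_density)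

lemma student_t_pdf_tail:
  assumes v: "v > 0"
  shows "((\<lambda>x. student_t_pdf v x * x powr (v + 1))
           \<longlongrightarrow> student_t_const v * v powr ((v + 1) / 2)) at_top"
proof (rule Lim_transform_eventually)
  define q where "q = (v + 1) / 2"
  have q: "- (v + 1) / 2 = - q" "v + 1 = 2 * q"
    unfolding q_def by (rule minus_divide_left[symmetric]) simp
  have "((\<lambda>x. x\<^sup>2 / (1 + x\<^sup>2 / v)) \<longlongrightarrow> v) at_top"
    using v by real_asymp
  then have "((\<lambda>x. (x\<^sup>2 / (1 + x\<^sup>2 / v)) powr q) \<longlongrightarrow> v powr q) at_top"
    using v by (intro tendsto_powr[OF _ tendsto_const]) simp_all
  then show "((\<lambda>x. student_t_const v * (x\<^sup>2 / (1 + x\<^sup>2 / v)) powr ((v + 1) / 2))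
      \<longlongrightarrow> student_t_const v * v powr ((v + 1) / 2)) at_top"
    unfolding q_def by (rule tendsto_mult[OF tendsto_const])
  have eq: "(x\<^sup>2 / (1 + x\<^sup>2 / v)) powr q = (1 + x\<^sup>2 / v) powr - q * x powr (2 * q)" if x: "x > 0" for x
  proof -
    have "x\<^sup>2 powr q = x powr (2 * q)"
      using powr_powr[of x 2 q] x by simp
    moreover have "(x\<^sup>2 / (1 + x\<^sup>2 / v)) powr q = x\<^sup>2 powr q / (1 + x\<^sup>2 / v) powr q"
      by (rule powr_divide)
    ultimately show ?thesis by (simp only: powr_minus divide_inverse mult.commute)
  qed
  show "eventually (\<lambda>x. student_t_const v * (x\<^sup>2 / (1 + x\<^sup>2 / v)) powr ((v + 1) / 2)
      = student_t_pdf v x * x powr (v + 1)) at_top"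
    using eventually_gt_at_top[of 0]
  proof eventually_elim
    case (elim x)
    show ?case
      using eq[OF elim] unfolding student_t_pdf_def q(1) q_def[symmetric] unfolding q(2) by simp
  qed
qed

lemma student_t_cdf_measurable[measurable]:
  assumes "v > 0"
  shows "student_t_cdf v \<in> borel_measurable borel"
proof -
  interpret real_distribution "student_t v" using assms by (rule real_distribution_student_t)
  show ?thesis unfolding student_t_cdf_def
    by (intro borel_measurable_mono monoI cdf_nondecreasing)
qed

lemma student_t_cdf_nonneg: "v > 0 \<Longrightarrow> student_t_cdf v x \<ge> 0"
  unfolding student_t_cdf_def
  by (intro finite_borel_measure.cdf_nonneg real_distribution.finite_borel_measure_M
      real_distribution_student_t)

lemma isCont_student_t_cdf: "v > 0 \<Longrightarrow> isCont (student_t_cdf v) x"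
  using prob_space_student_t[of v] unfolding student_t_cdf_def student_t_def
  by (intro isCont_cdf_density) auto

lemma student_t_cdf_uminus: "v > 0 \<Longrightarrow> student_t_cdf v (- x) = 1 - student_t_cdf v x"
  using prob_space_student_t[of v] unfolding student_t_cdf_def student_t_def
  by (intro cdf_density_uminus) (auto simp: student_t_pdf_even)

text \<open>By symmetry, positivity at \<open>x\<close> amounts to a positive upper tail at \<open>- x\<close>.\<close>

lemma student_t_cdf_pos:
  assumes v: "v > 0"
  shows "student_t_cdf v x > 0"
proof -
  interpret real_distribution "student_t v" using v by (rule real_distribution_student_t)
  have mono: "mono (cdf (student_t v))"
    by (intro monoI cdf_nondecreasing)
  have "((\<lambda>x. x powr v * (1 - cdf (student_t v) x))
      \<longlongrightarrow> student_t_const v * v powr ((v + 1) / 2) / v) at_top"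
    unfolding student_t_def
    using v prob_space_student_t[OF v, unfolded student_t_def] student_t_pdf_tail[OF v]
    by (intro tail_density_regular_variation) (auto simp: student_t_pdf_nonneg)
  then have "cdf (student_t v) (- x) < 1"
    by (rule less_1_of_tail_limit[OF mono])
      (use v in \<open>simp add: student_t_const_pos\<close>)
  then show ?thesis
    using student_t_cdf_uminus[OF v, of x] by (simp add: student_t_cdf_def)
qed

section \<open>The skew-t distribution\<close>

text \<open>
  Azzalini's construction. The reflection \<open>x \<mapsto> - x\<close> turns the integral of \<open>2 * f x * g x\<close> into that
  of \<open>2 * f x * (1 - g x)\<close>, and the two integrals add up to \<open>2 * \<integral> f = 2\<close>; so each is \<open>1\<close>.
\<close>

lemma prob_space_skew_symmetric:
  fixes f g :: "real \<Rightarrow> real"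
  assumes prob: "prob_space (density lborel (\<lambda>x. ennreal (f x)))"
    and [measurable]: "f \<in> borel_measurable borel" "g \<in> borel_measurable borel"
    and f: "\<And>x. f x \<ge> 0" "\<And>x. f (- x) = f x"
    and g: "\<And>x. g x \<ge> 0" "\<And>x. g (- x) = 1 - g x"
  shows "prob_space (density lborel (\<lambda>x. ennreal (2 * f x * g x)))"
proof
  let ?I = "\<integral>\<^sup>+x. ennreal (2 * f x * g x) \<partial>lborel"
  interpret prob_space "density lborel (\<lambda>x. ennreal (f x))" by fact
  have one: "(\<integral>\<^sup>+x. ennreal (f x) \<partial>lborel) = 1"
    using emeasure_space_1 by (simp add: emeasure_density)
  have "?I = (\<integral>\<^sup>+x. ennreal (2 * f x * g (- x)) \<partial>lborel)"
    by (subst nn_integral_real_affine[where c = "-1" and t = 0]) (auto simp: f)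
  then have "?I + ?I = ?I + (\<integral>\<^sup>+x. ennreal (2 * f x * g (- x)) \<partial>lborel)"
    by (rule arg_cong)
  also have "\<dots> = (\<integral>\<^sup>+x. ennreal (2 * f x * g x) + ennreal (2 * f x * g (- x)) \<partial>lborel)"
    by (rule nn_integral_add[symmetric]) measurable
  also have "\<dots> = (\<integral>\<^sup>+x. 2 * ennreal (f x) \<partial>lborel)"
  proof (intro nn_integral_cong)
    fix x :: real
    have "ennreal (2 * f x * g x) + ennreal (2 * f x * g (- x))
        = ennreal (2 * f x * g x + 2 * f x * g (- x))"
      using f(1)[of x] g(1)[of x] g(1)[of "- x"] by (intro ennreal_plus[symmetric]) auto
    also have "2 * f x * g x + 2 * f x * g (- x) = 2 * f x"
      by (simp add: g(2) algebra_simps)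
    finally show "ennreal (2 * f x * g x) + ennreal (2 * f x * g (- x)) = 2 * ennreal (f x)"
      by (simp add: ennreal_mult')
  qed
  also have "\<dots> = 2" by (simp add: nn_integral_cmult one)
  finally have two: "?I + ?I = 2" .
  have "?I = 1"
  proof (cases ?I)
    case (real r)
    then show ?thesis using two
      by (simp add: ennreal_plus[symmetric] flip: ennreal_numeral ennreal_1 del: ennreal_plus)
  next
    case top
    then show ?thesis using two by simp
  qed
  then show "emeasure (density lborel (\<lambda>x. ennreal (2 * f x * g x)))
      (space (density lborel (\<lambda>x. ennreal (2 * f x * g x)))) = 1"
    by (simp add: emeasure_density)
qed

lemma skew_t_pdf_measurable[measurable]:
  assumes "v > 0"
  shows "skew_t_pdf v \<beta> \<in> borel_measurable borel"
proof -
  have [measurable]: "student_t_cdf (v + 1) \<in> borel_measurable borel"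
    using assms by simp
  show ?thesis unfolding skew_t_pdf_def by measurable
qed

lemma skew_t_pdf_nonneg: "v > 0 \<Longrightarrow> skew_t_pdf v \<beta> x \<ge> 0"
  by (simp add: skew_t_pdf_def student_t_pdf_nonneg student_t_cdf_nonneg)

lemma prob_space_skew_t:
  assumes v: "v > 0"
  shows "prob_space (skew_t v \<beta>)"
proof -
  have [measurable]: "student_t_cdf (v + 1) \<in> borel_measurable borel"
    using v by simp
  show ?thesis
    unfolding skew_t_def skew_t_pdf_def
    using v prob_space_student_t[OF v]
    by (intro prob_space_skew_symmetric)
      (auto simp: student_t_def student_t_pdf_nonneg student_t_pdf_even student_t_cdf_nonneg
        student_t_cdf_uminus)
qed

lemma real_distribution_skew_t: "v > 0 \<Longrightarrow> real_distribution (skew_t v \<beta>)"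
  using prob_space_skew_t[of v \<beta>] by (simp add: skew_t_def real_distribution_density)

lemma skew_t_tail:
  assumes v: "v > 0"
  shows "((\<lambda>x. x powr v * (1 - skew_t_cdf v \<beta> x))
           \<longlongrightarrow> 2 * student_t_const v * student_t_cdf (v + 1) (\<beta> * sqrt (v + 1))
               * v powr ((v - 1) / 2)) at_top"
proof -
  let ?T = "student_t_cdf (v + 1)"
  let ?w = "\<lambda>x. \<beta> * x * sqrt ((v + 1) / (x\<^sup>2 + v))"
  have "((\<lambda>x. \<beta> * sqrt ((v + 1) / (1 + v / x\<^sup>2))) \<longlongrightarrow> \<beta> * sqrt ((v + 1) / (1 + 0))) at_top"
    using v by (intro tendsto_intros tendsto_divide_0[OF tendsto_const] filterlim_at_top_imp_at_infinity
        filterlim_pow_at_top filterlim_ident) auto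
  moreover have "eventually (\<lambda>x. \<beta> * sqrt ((v + 1) / (1 + v / x\<^sup>2)) = ?w x) at_top"
    using eventually_gt_at_top[of 0]
  proof eventually_elim
    case (elim x)
    have "(v + 1) / (1 + v / x\<^sup>2) = x\<^sup>2 * ((v + 1) / (x\<^sup>2 + v))"
      using elim v by (simp add: field_simps add_nonneg_eq_0_iff)
    then have "sqrt ((v + 1) / (1 + v / x\<^sup>2)) = x * sqrt ((v + 1) / (x\<^sup>2 + v))"
      using elim by (simp only: real_sqrt_mult real_sqrt_abs abs_of_pos)
    then show ?case by simp
  qed
  ultimately have "(?w \<longlongrightarrow> \<beta> * sqrt (v + 1)) at_top"
    by (simp add: tendsto_cong)
  then have "((\<lambda>x. ?T (?w x)) \<longlongrightarrow> ?T (\<beta> * sqrt (v + 1))) at_top"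
    using v by (intro isCont_tendsto_compose[OF isCont_student_t_cdf]) auto
  then have "((\<lambda>x. 2 * (student_t_pdf v x * x powr (v + 1)) * ?T (?w x))
      \<longlongrightarrow> 2 * (student_t_const v * v powr ((v + 1) / 2)) * ?T (\<beta> * sqrt (v + 1))) at_top"
    by (intro tendsto_intros student_t_pdf_tail v)
  then have "((\<lambda>x. skew_t_pdf v \<beta> x * x powr (v + 1))
      \<longlongrightarrow> 2 * (student_t_const v * v powr ((v + 1) / 2)) * ?T (\<beta> * sqrt (v + 1))) at_top"
    by (simp add: skew_t_pdf_def mult_ac)
  then have "((\<lambda>x. x powr v * (1 - cdf (density lborel (\<lambda>x. ennreal (skew_t_pdf v \<beta> x))) x))
      \<longlongrightarrow> 2 * (student_t_const v * v powr ((v + 1) / 2)) * ?T (\<beta> * sqrt (v + 1)) / v) at_top"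
    using v prob_space_skew_t[OF v, of \<beta>, unfolded skew_t_def]
    by (intro tail_density_regular_variation) (auto simp: skew_t_pdf_nonneg)
  moreover have "v powr ((v + 1) / 2) = v * v powr ((v - 1) / 2)"
  proof -
    have "(v + 1) / 2 = 1 + (v - 1) / 2" by (simp add: field_simps)
    then show ?thesis using v by (simp only: powr_add powr_one)
  qed
  ultimately show ?thesis
    using v by (simp add: skew_t_cdf_def skew_t_def mult_ac)
qed

section \<open>Mixtures and powers of their distribution functions\<close>

lemma mixed_skew_t_cdf_mono:
  assumes "\<And>i. i \<in> {1..r} \<Longrightarrow> v i > 0" and "\<And>i. i \<in> {1..r} \<Longrightarrow> p i > 0" and "x \<le> y"
  shows "mixed_skew_t_cdf r p v \<beta> x \<le> mixed_skew_t_cdf r p v \<beta> y"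
  unfolding mixed_skew_t_cdf_def skew_t_cdf_def using assms
  by (intro sum_mono mult_left_mono finite_borel_measure.cdf_nondecreasing
      real_distribution.finite_borel_measure_M real_distribution_skew_t) (auto intro: less_imp_le)

lemma mixed_skew_t_cdf_nonneg:
  assumes "\<And>i. i \<in> {1..r} \<Longrightarrow> v i > 0" and "\<And>i. i \<in> {1..r} \<Longrightarrow> p i > 0"
  shows "mixed_skew_t_cdf r p v \<beta> x \<ge> 0"
  unfolding mixed_skew_t_cdf_def skew_t_cdf_def using assms
  by (intro sum_nonneg mult_nonneg_nonneg finite_borel_measure.cdf_nonneg
      real_distribution.finite_borel_measure_M real_distribution_skew_t) (auto intro: less_imp_le)

text \<open>
  The mass of component \<open>i\<close> beyond \<open>x\<close> is of order \<open>x powr (- v i)\<close>. On the scale \<open>x powr v 1\<close> each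
  component with \<open>v i > v 1\<close> is damped by the factor \<open>x powr (v 1 - v i)\<close>, so only the first one
  contributes to the limit.
\<close>

lemma mixed_skew_t_tail:
  fixes r :: nat and p v \<beta> :: "nat \<Rightarrow> real"
  assumes r: "r \<ge> 1"
    and v1: "0 < v 1"
    and v: "\<And>i. i \<in> {2..r} \<Longrightarrow> v 1 < v i"
    and p: "(\<Sum>i = 1..r. p i) = 1"
  shows "((\<lambda>x. x powr v 1 * (1 - mixed_skew_t_cdf r p v \<beta> x))
           \<longlongrightarrow> 2 * p 1 * student_t_const (v 1) * student_t_cdf (v 1 + 1) (\<beta> 1 * sqrt (v 1 + 1))
               * v 1 powr ((v 1 - 1) / 2)) at_top"
proof -
  define c where "c i = 2 * student_t_const (v i)
    * student_t_cdf (v i + 1) (\<beta> i * sqrt (v i + 1)) * v i powr ((v i - 1) / 2)" for i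
  have split: "{1..r} = insert 1 {2..r}" using r by auto
  let ?h = "\<lambda>i x. x powr (v 1 - v i) * (x powr v i * (1 - skew_t_cdf (v i) (\<beta> i) x))"
  have first: "((\<lambda>x. x powr v 1 * (1 - skew_t_cdf (v 1) (\<beta> 1) x)) \<longlongrightarrow> c 1) at_top"
    unfolding c_def by (rule skew_t_tail) fact
  have rest: "(?h i \<longlongrightarrow> 0 * c i) at_top" if "i \<in> {2..r}" for i
  proof (intro tendsto_mult)
    show "((\<lambda>x. x powr (v 1 - v i)) \<longlongrightarrow> 0) at_top"
      using v[OF that] by (intro tendsto_neg_powr filterlim_ident) auto
    show "((\<lambda>x. x powr v i * (1 - skew_t_cdf (v i) (\<beta> i) x)) \<longlongrightarrow> c i) at_top"
      unfolding c_def using v[OF that] v1 by (intro skew_t_tail) auto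
  qed
  have "((\<lambda>x. p 1 * (x powr v 1 * (1 - skew_t_cdf (v 1) (\<beta> 1) x)) + (\<Sum>i = 2..r. p i * ?h i x))
      \<longlongrightarrow> p 1 * c 1 + (\<Sum>i = 2..r. p i * (0 * c i))) at_top"
    by (intro tendsto_add tendsto_mult tendsto_sum tendsto_const first rest)
  moreover have "eventually (\<lambda>x. p 1 * (x powr v 1 * (1 - skew_t_cdf (v 1) (\<beta> 1) x))
        + (\<Sum>i = 2..r. p i * ?h i x)
      = x powr v 1 * (1 - mixed_skew_t_cdf r p v \<beta> x)) at_top"
    using eventually_gt_at_top[of 0]
  proof eventually_elim
    case (elim x)
    have "1 - mixed_skew_t_cdf r p v \<beta> x = (\<Sum>i = 1..r. p i * (1 - skew_t_cdf (v i) (\<beta> i) x))"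
      by (simp add: mixed_skew_t_cdf_def right_diff_distrib sum_subtractf p[simplified])
    also have "x powr v 1 * \<dots> = (\<Sum>i = 1..r. p i * (x powr v 1 * (1 - skew_t_cdf (v i) (\<beta> i) x)))"
      by (simp add: sum_distrib_left mult_ac)
    also have "\<dots> = p 1 * (x powr v 1 * (1 - skew_t_cdf (v 1) (\<beta> 1) x))
        + (\<Sum>i = 2..r. p i * ?h i x)"
      using elim unfolding split by (simp add: mult.assoc[symmetric] flip: powr_add)
    finally show ?case by simp
  qed
  ultimately show ?thesis by (simp add: tendsto_cong c_def mult_ac)
qed

text \<open>
  The convergence of \<open>n * u n\<close> forces \<open>u n \<longlonglongrightarrow> 0\<close>, so that \<open>n * ln (1 - u n)\<close> can be squeezed between
  \<open>- n * u n - 2 * n * (u n)\<^sup>2\<close> and \<open>- n * u n\<close>, whose difference vanishes in the limit.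
\<close>

lemma power_tendsto_exp_of_mean:
  fixes u :: "nat \<Rightarrow> real"
  assumes nonneg: "\<And>n. u n \<ge> 0" and lim: "(\<lambda>n. real n * u n) \<longlonglongrightarrow> z"
  shows "(\<lambda>n. (1 - u n) ^ n) \<longlonglongrightarrow> exp (- z)"
proof -
  have "(\<lambda>n. (real n * u n) * (1 / real n)) \<longlonglongrightarrow> z * 0"
    by (intro tendsto_mult lim lim_1_over_n)
  moreover have "eventually (\<lambda>n. (real n * u n) * (1 / real n) = u n) sequentially"
    using eventually_gt_at_top[of 0] by eventually_elim simp
  ultimately have u0: "u \<longlonglongrightarrow> 0" by (simp add: tendsto_cong)
  then have small: "eventually (\<lambda>n. u n < 1 / 2) sequentially"
    by (rule order_tendstoD) simp
  have "(\<lambda>n. real n * ln (1 - u n)) \<longlonglongrightarrow> - z"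
  proof (rule tendsto_sandwich)
    show "eventually (\<lambda>n. - (real n * u n) - 2 * (real n * u n) * u n \<le> real n * ln (1 - u n)) sequentially"
      using small
    proof eventually_elim
      case (elim n)
      have "real n * (- u n - 2 * (u n)\<^sup>2) \<le> real n * ln (1 - u n)"
        using elim nonneg by (intro mult_left_mono ln_one_minus_pos_lower_bound) (auto intro: less_imp_le)
      then show ?case by (simp add: algebra_simps power2_eq_square)
    qed
    show "eventually (\<lambda>n. real n * ln (1 - u n) \<le> - (real n * u n)) sequentially"
      using small
    proof eventually_elim
      case (elim n)
      have "ln (1 - u n) \<le> - u n"
        using ln_le_minus_one[of "1 - u n"] elim by simp
      then have "real n * ln (1 - u n) \<le> real n * - u n"
        by (intro mult_left_mono) auto
      then show ?case by simp
    qed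
    have "(\<lambda>n. - (real n * u n) - 2 * (real n * u n) * u n) \<longlonglongrightarrow> - z - 2 * z * 0"
      by (intro tendsto_intros lim u0)
    then show "(\<lambda>n. - (real n * u n) - 2 * (real n * u n) * u n) \<longlonglongrightarrow> - z" by simp
    show "(\<lambda>n. - (real n * u n)) \<longlonglongrightarrow> - z" by (intro tendsto_intros lim)
  qed
  then have "(\<lambda>n. exp (real n * ln (1 - u n))) \<longlonglongrightarrow> exp (- z)"
    by (rule tendsto_exp)
  moreover have "eventually (\<lambda>n. exp (real n * ln (1 - u n)) = (1 - u n) ^ n) sequentially"
    using small by eventually_elim (simp add: exp_of_nat_mult)
  ultimately show ?thesis by (simp add: tendsto_cong)
qed

theorem proposition2p2:
  fixes r :: nat and p v \<beta> :: "nat \<Rightarrow> real" and F :: "real \<Rightarrow> real"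
    and a \<alpha>n \<beta>n :: "nat \<Rightarrow> real" and x :: real
  assumes "r \<ge> 1"
    and "0 < v 1"
    and "strict_mono_on {1..r} v"
    and "\<And>i. i \<in> {1..r} \<Longrightarrow> p i > 0"
    and "(\<Sum>i = 1..r. p i) = 1"
    and "F = mixed_skew_t_cdf r p v \<beta>"
    and "\<And>n. a n =
           (2 * p 1 * student_t_const (v 1) * student_t_cdf (v 1 + 1) (\<beta> 1 * sqrt (v 1 + 1)))
             powr (1 / v 1)
           * v 1 powr ((v 1 - 1) / (2 * v 1))
           * real n powr (1 / v 1)"
    and "\<And>n. \<alpha>n n = a n"
    and "\<And>n. \<beta>n n = 1 / v 1"
  shows "(\<lambda>n. F (\<alpha>n n * \<bar>x\<bar> powr \<beta>n n * sgn x) ^ n) \<longlonglongrightarrow> Phi_1 x"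
proof -
  define A where "A = 2 * p 1 * student_t_const (v 1) * student_t_cdf (v 1 + 1) (\<beta> 1 * sqrt (v 1 + 1))"
  define K where "K = A * v 1 powr ((v 1 - 1) / 2)"
  have v1: "v 1 > 0" by fact
  have vgt: "v 1 < v i" if "i \<in> {2..r}" for i
    using that assms(1) by (intro strict_mono_onD[OF assms(3)]) auto
  have vpos: "v i > 0" if "i \<in> {1..r}" for i
    using that vgt[of i] v1 by (cases "i = 1") auto
  have p1: "p 1 > 0" using assms(1,4) by auto
  have A: "A > 0"
    unfolding A_def using p1 v1 by (simp add: student_t_const_pos student_t_cdf_pos)
  then have K: "K > 0" using v1 by (simp add: K_def)
  have tail: "((\<lambda>y. y powr v 1 * (1 - F y)) \<longlongrightarrow> K) at_top"
    unfolding assms(6) K_def A_def using assms(1) v1 vgt assms(5) by (rule mixed_skew_t_tail)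
  have mono: "F y \<le> F z" if "y \<le> z" for y z
    unfolding assms(6) using vpos assms(4) that by (rule mixed_skew_t_cdf_mono)
  have nonneg: "F y \<ge> 0" for y
    unfolding assms(6) using vpos assms(4) by (rule mixed_skew_t_cdf_nonneg)
  have less1: "F y < 1" for y
    using tail K by (intro less_1_of_tail_limit) (auto intro: monoI mono)
  have a: "a n = (K * real n) powr (1 / v 1)" for n
  proof -
    have "(v 1 powr ((v 1 - 1) / 2)) powr (1 / v 1) = v 1 powr ((v 1 - 1) / (2 * v 1))"
      by (simp add: powr_powr)
    then show ?thesis unfolding assms(7) A_def[symmetric] K_def using A by (simp add: powr_mult)
  qed
  show ?thesis
  proof (cases "x > 0")
    case True
    define y where "y n = (K * real n * x) powr (1 / v 1)" for n
    have arg: "\<alpha>n n * \<bar>x\<bar> powr \<beta>n n * sgn x = y n" for n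
      using True K by (simp add: assms(8,9) a y_def powr_mult)
    have "filterlim (\<lambda>n. K * real n * x) at_top sequentially"
      using K True
      by (intro filterlim_at_top_mult_tendsto_pos[OF tendsto_const]
          filterlim_tendsto_pos_mult_at_top[OF tendsto_const] filterlim_real_sequentially) auto
    then have "filterlim y at_top sequentially"
      unfolding y_def using v1 by (intro filterlim_compose[OF real_powr_at_top]) auto
    then have "(\<lambda>n. y n powr v 1 * (1 - F (y n))) \<longlonglongrightarrow> K"
      by (rule filterlim_compose[OF tail])
    then have "(\<lambda>n. y n powr v 1 * (1 - F (y n)) / (K * x)) \<longlonglongrightarrow> K / (K * x)"
      using K True by (intro tendsto_intros) auto
    moreover have "y n powr v 1 * (1 - F (y n)) / (K * x) = real n * (1 - F (y n))" for n
      using K True v1 by (simp add: y_def powr_powr field_simps)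
    moreover have "K / (K * x) = inverse x" using K by (simp add: field_simps)
    ultimately have "(\<lambda>n. real n * (1 - F (y n))) \<longlonglongrightarrow> inverse x"
      by (simp only:)
    then have "(\<lambda>n. (1 - (1 - F (y n))) ^ n) \<longlonglongrightarrow> exp (- inverse x)"
      using less1 by (intro power_tendsto_exp_of_mean) (auto intro: less_imp_le)
    then show ?thesis unfolding arg Phi_1_def using True by simp
  next
    case False
    have "\<alpha>n n * \<bar>x\<bar> powr \<beta>n n * sgn x \<le> 0" for n
      using False by (auto simp: assms(8) a sgn_if mult_nonneg_nonpos)
    then have le: "F (\<alpha>n n * \<bar>x\<bar> powr \<beta>n n * sgn x) \<le> F 0" for n
      by (rule mono)
    have "(\<lambda>n. F (\<alpha>n n * \<bar>x\<bar> powr \<beta>n n * sgn x) ^ n) \<longlonglongrightarrow> 0"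
    proof (rule tendsto_sandwich[OF _ _ tendsto_const])
      show "(\<lambda>n. F 0 ^ n) \<longlonglongrightarrow> 0"
        using nonneg less1 by (intro LIMSEQ_realpow_zero)
    qed (auto intro!: always_eventually power_mono nonneg le zero_le_power)
    then show ?thesis using False by (simp add: Phi_1_def)
  qed
qed

end
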